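(* The selective greedy method (described in the context), applied to a product family of Metzler matrices, does not cycle: the sequence of matrices $A_1,A_2,\dots$ it produces never returns to a previously visited matrix after having left it, i.e. there are no indices $k<l$ with $A_{k+1}\neq A_k$ and $A_l=A_k$, where $l\ge k+2$.
   Context: All matrices are real $d\times d$. A matrix is Metzler if its off-diagonal entries are non-negative. $\eta(A)$ is the spectral abscissa (largest real part of the eigenvalues); for a Metzler matrix it is an eigenvalue, and a corresponding eigenvector $\boldsymbol v\geqslant 0$, $\boldsymbol v\neq 0$, is called a leading eigenvector. $E$ is the matrix of all ones. The selected leading eigenvector of a Metzler matrix $A$ is $\lim_{\varepsilon\to0^+}\boldsymbol v_\varepsilon$, where $\boldsymbol v_\varepsilon$ is the normalized leading eigenvector of $A_\varepsilon=A+\varepsilon E$. Let $\mathcal M_i=\{\boldsymbol a\in\mathbb R^d: a_j\geqslant 0\text{ for }j\neq i\}$. A family $\mathcal F$ of Metzler matrices is a product family if there are compact sets $\mathcal F_i\subset\mathcal M_i$, $i=1,\dots,d$, such that $\mathcal F$ consists of all matrices whose $i$-th row belongs to $\mathcal F_i$ for every $i$. Greedy method (maximization of $\eta$). Start with an arbitrary $A_1\in\mathcal F$. Given $A_k\in\mathcal F$ with rows $A_k^{(i)}\in\mathcal F_i$, take a leading eigenvector $\boldsymbol v_k$ of $A_k$, and for each $i$ find $\hat A^{(i)}\in\mathcal F_i$ maximizing $\langle \boldsymbol a,\boldsymbol v_k\rangle$ over $\boldsymbol a\in\mathcal F_i$. If $\langle\hat A^{(i)},\boldsymbol v_k\rangle=\langle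 A_k^{(i)},\boldsymbol v_k\rangle$, set $A_{k+1}^{(i)}=A_k^{(i)}$; if $\langle\hat A^{(i)},\boldsymbol v_k\rangle>\langle A_k^{(i)},\boldsymbol v_k\rangle$, set $A_{k+1}^{(i)}=\hat A^{(i)}$. The method stops if $A_{k+1}=A_k$. The minimization version is the same with minimization of $\langle \boldsymbol a,\boldsymbol v_k\rangle$ and with the reversed strict inequality. The selective greedy method is the greedy method in which, in every iteration, $\boldsymbol v_k$ is the selected leading eigenvector of $A_k$. *)

theory Defs
  imports "HOL-Analysis.Analysis"
begin

definition metzler :: "real ^ 'd ^ 'd \<Rightarrow> bool" where
  "metzler A \<longleftrightarrow> (\<forall>i j. j \<noteq> i \<longrightarrow> 0 \<le> A $ i $ j)"

definition eigenvalues :: "real ^ 'd ^ 'd \<Rightarrow> complex set" where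
  "eigenvalues A = {z. \<exists>x. x \<noteq> 0 \<and> map_matrix complex_of_real A *v x = z *s x}"

definition spectral_abscissa :: "real ^ 'd ^ 'd \<Rightarrow> real" where
  "spectral_abscissa A = Max (Re ` eigenvalues A)"

definition leading_eigenvector :: "real ^ 'd ^ 'd \<Rightarrow> real ^ 'd \<Rightarrow> bool" where
  "leading_eigenvector A v \<longleftrightarrow>
     (\<forall>i. 0 \<le> v $ i) \<and> v \<noteq> 0 \<and> A *v v = spectral_abscissa A *\<^sub>R v"

definition ones_matrix :: "real ^ 'd ^ 'd" where
  "ones_matrix = (\<chi> i j. 1)"

text \<open>For a Metzler matrix \<open>A\<close> and \<open>\<epsilon> > 0\<close>, all off-diagonal entries of \<open>A + \<epsilon> E\<close> are
  positive, so its leading eigenvector is unique up to scaling and \<open>w \<epsilon>\<close> below is uniquely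
  determined. Vectors are normalized in the Euclidean norm; another norm would only rescale the
  limit by a positive factor.\<close>

definition selected_leading_eigenvector :: "real ^ 'd ^ 'd \<Rightarrow> real ^ 'd \<Rightarrow> bool" where
  "selected_leading_eigenvector A v \<longleftrightarrow>
     (\<exists>w. (\<forall>\<epsilon>>0. leading_eigenvector (A + \<epsilon> *\<^sub>R ones_matrix) (w \<epsilon>) \<and> norm (w \<epsilon>) = 1) \<and>
          (w \<longlongrightarrow> v) (at_right 0))"

definition metzler_rows :: "'d \<Rightarrow> (real ^ 'd) set" where
  "metzler_rows i = {a. \<forall>j. j \<noteq> i \<longrightarrow> 0 \<le> a $ j}"

definition product_family_rows :: "('d \<Rightarrow> (real ^ 'd) set) \<Rightarrow> bool" where
  "product_family_rows F \<longleftrightarrow> (\<forall>i. compact (F i) \<and> F i \<subseteq> metzler_rows i)"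

definition product_family :: "('d \<Rightarrow> (real ^ 'd) set) \<Rightarrow> (real ^ 'd ^ 'd) set" where
  "product_family F = {A. \<forall>i. row i A \<in> F i}"

lemma product_family_metzler:
  assumes "product_family_rows F" and "A \<in> product_family F"
  shows "metzler A"
  unfolding metzler_def
proof (intro allI impI)
  fix i j :: 'a assume ne: "j \<noteq> i"
  have "row i A \<in> metzler_rows i"
    using assms unfolding product_family_rows_def product_family_def by blast
  with ne show "0 \<le> A $ i $ j"
    by (simp add: metzler_rows_def row_def)
qed

definition greedy_step_max ::
  "('d \<Rightarrow> (real ^ 'd) set) \<Rightarrow> real ^ 'd ^ 'd \<Rightarrow> real ^ 'd \<Rightarrow> real ^ 'd ^ 'd \<Rightarrow> bool" where
  "greedy_step_max F A v A' \<longleftrightarrow>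
     (\<exists>B. \<forall>i. row i B \<in> F i \<and> (\<forall>a\<in>F i. a \<bullet> v \<le> row i B \<bullet> v) \<and>
        row i A' = (if row i B \<bullet> v > row i A \<bullet> v then row i B else row i A))"

definition greedy_step_min ::
  "('d \<Rightarrow> (real ^ 'd) set) \<Rightarrow> real ^ 'd ^ 'd \<Rightarrow> real ^ 'd \<Rightarrow> real ^ 'd ^ 'd \<Rightarrow> bool" where
  "greedy_step_min F A v A' \<longleftrightarrow>
     (\<exists>B. \<forall>i. row i B \<in> F i \<and> (\<forall>a\<in>F i. row i B \<bullet> v \<le> a \<bullet> v) \<and>
        row i A' = (if row i B \<bullet> v < row i A \<bullet> v then row i B else row i A))"

text \<open>\<open>N\<close> is the number of iterations performed. It is \<open>\<infinity>\<close> if the method never stops; a finite run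
  may be a complete one or an initial part of one. The last conjunct is the stopping rule: no
  further iteration takes place once a matrix is repeated by its successor. The starting matrix is
  \<open>A 0\<close>, and \<open>v k\<close> is the eigenvector used to pass from \<open>A k\<close> to \<open>A (Suc k)\<close>.\<close>

definition greedy_run ::
  "(real ^ 'd ^ 'd \<Rightarrow> real ^ 'd \<Rightarrow> real ^ 'd ^ 'd \<Rightarrow> bool) \<Rightarrow> ('d \<Rightarrow> (real ^ 'd) set) \<Rightarrow>
   enat \<Rightarrow> (nat \<Rightarrow> real ^ 'd ^ 'd) \<Rightarrow> (nat \<Rightarrow> real ^ 'd) \<Rightarrow> bool" where
  "greedy_run step F N A v \<longleftrightarrow>
     A 0 \<in> product_family F \<and>
     (\<forall>k. enat k < N \<longrightarrow> leading_eigenvector (A k) (v k) \<and> step (A k) (v k) (A (Suc k))) \<and>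
     (\<forall>k. enat k < N \<and> A (Suc k) = A k \<longrightarrow> N = enat (Suc k))"

definition selective_greedy_run ::
  "(real ^ 'd ^ 'd \<Rightarrow> real ^ 'd \<Rightarrow> real ^ 'd ^ 'd \<Rightarrow> bool) \<Rightarrow> ('d \<Rightarrow> (real ^ 'd) set) \<Rightarrow>
   enat \<Rightarrow> (nat \<Rightarrow> real ^ 'd ^ 'd) \<Rightarrow> (nat \<Rightarrow> real ^ 'd) \<Rightarrow> bool" where
  "selective_greedy_run step F N A v \<longleftrightarrow>
     greedy_run step F N A v \<and> (\<forall>k. enat k < N \<longrightarrow> selected_leading_eigenvector (A k) (v k))"

end

theory Submission
  imports Defs
begin

text \<open>For small \<open>\<epsilon> > 0\<close> the perturbed spectral abscissa \<open>\<eta>(A\<^sub>k + \<epsilon> E)\<close> strictly improves with every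
  change of the matrix: a row is replaced only if this strictly improves its product with the
  selected eigenvector, hence also with the nearby leading eigenvector of \<open>A\<^sub>k + \<epsilon> E\<close>, and all
  off-diagonal entries of \<open>A\<^sub>k\<^sub>+\<^sub>1 + \<epsilon> E\<close> are positive. A cycle involves only finitely many steps, so one
  \<open>\<epsilon>\<close> serves all of them, and returning to \<open>A\<^sub>k\<close> would give \<open>\<eta>(A\<^sub>k + \<epsilon> E)\<close> strictly better than itself.\<close>

section \<open>Matrices with positive off-diagonal entries\<close>

lemma matrix_vector_mult_nth_split:
  fixes B :: "real ^ 'd ^ 'd"
  shows "(B *v x) $ i = B $ i $ i * x $ i + (\<Sum>j\<in>UNIV - {i}. B $ i $ j * x $ j)"
  by (simp add: matrix_vector_mult_def sum.remove[of UNIV i])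

text \<open>A minimum principle: \<open>x $ i = 0\<close> removes the diagonal term, the only one of
  unknown sign, so a sum of non-negative terms is at most zero and each term vanishes; the positive
  weights then force all of \<open>x\<close> to vanish.\<close>

lemma offdiag_pos_null_entry:
  fixes B :: "real ^ 'd ^ 'd"
  assumes B: "\<And>i j. j \<noteq> i \<Longrightarrow> 0 < B $ i $ j"
    and x: "\<And>j. 0 \<le> x $ j" and xi: "x $ i = 0" and Bx: "(B *v x) $ i \<le> 0"
  shows "x = 0"
proof -
  have nn: "0 \<le> B $ i $ j * x $ j" if "j \<in> UNIV - {i}" for j
    using B[of j i] x[of j] that by simp
  have "(\<Sum>j\<in>UNIV - {i}. B $ i $ j * x $ j) \<le> 0"
    using Bx xi by (simp add: matrix_vector_mult_nth_split)
  then have "(\<Sum>j\<in>UNIV - {i}. B $ i $ j * x $ j) = 0"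
    using nn by (intro antisym sum_nonneg)
  then have z: "\<forall>j\<in>UNIV - {i}. B $ i $ j * x $ j = 0"
    by (subst (asm) sum_nonneg_eq_0_iff) (use nn in auto)
  have "x $ j = 0" for j
  proof (cases "j = i")
    case False
    then have "B $ i $ j * x $ j = 0" and "0 < B $ i $ j"
      using z B by auto
    then show ?thesis by simp
  qed (simp add: xi)
  then show ?thesis by (simp add: vec_eq_iff)
qed

text \<open>The positivity part of Perron-Frobenius: at a zero entry the eigenvalue equation has
  right-hand side zero, and the minimum principle would give \<open>w = 0\<close>.\<close>

lemma leading_eigenvector_pos:
  fixes B :: "real ^ 'd ^ 'd"
  assumes B: "\<And>i j. j \<noteq> i \<Longrightarrow> 0 < B $ i $ j" and w: "leading_eigenvector B w"
  shows "0 < w $ i"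
proof (rule ccontr)
  assume "\<not> 0 < w $ i"
  with w have "w $ i = 0"
    unfolding leading_eigenvector_def by (metis order_le_less)
  moreover from this w have "(B *v w) $ i \<le> 0"
    by (simp add: leading_eigenvector_def)
  ultimately have "w = 0"
    using w by (intro offdiag_pos_null_entry[OF B, where x = w and i = i])
      (auto simp: leading_eigenvector_def)
  with w show False by (simp add: leading_eigenvector_def)
qed

text \<open>A Collatz-Wielandt comparison. The least multiple of \<open>p\<close> lying above
  \<open>q\<close> touches \<open>q\<close> at some index, so the minimum principle makes
  \<open>p\<close> and \<open>q\<close> proportional, and opposite inequalities for proportional
  vectors are equalities.\<close>

lemma offdiag_pos_sub_supersolution:
  fixes B :: "real ^ 'd ^ 'd"
  assumes B: "\<And>i j. j \<noteq> i \<Longrightarrow> 0 < B $ i $ j"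
    and p: "\<And>i. 0 < p $ i" and q: "\<And>i. 0 < q $ i"
    and Bp: "\<And>i. (B *v p) $ i \<le> c * p $ i" and Bq: "\<And>i. c * q $ i \<le> (B *v q) $ i"
  shows "(B *v p) $ i = c * p $ i \<and> (B *v q) $ i = c * q $ i"
proof -
  \<comment> \<open>\<open>u\<close> is the non-negative combination that touches zero, at the index \<open>m\<close>.\<close>
  define t where "t = Max (range (\<lambda>i. q $ i / p $ i))"
  have "t \<in> range (\<lambda>i. q $ i / p $ i)"
    unfolding t_def by (rule Max_in) auto
  then obtain m where m: "t = q $ m / p $ m" by auto
  have t: "0 < t" using m p q by simp
  define u where "u = t *\<^sub>R p - q"
  have u0: "0 \<le> u $ j" for j
  proof -
    have "q $ j / p $ j \<le> t" unfolding t_def by (rule Max_ge) auto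
    then show ?thesis using p[of j] by (simp add: u_def field_simps)
  qed
  have um: "u $ m = 0" using p[of m] by (simp add: u_def m)
  have Bu: "(B *v u) $ j = t * (B *v p) $ j - (B *v q) $ j" for j
    by (simp add: u_def matrix_vector_mult_diff_distrib matrix_vector_mult_scaleR)
  have tp: "t * (B *v p) $ j \<le> t * (c * p $ j)" for j
    using Bp[of j] t by simp
  \<comment> \<open>Here \<open>c * u $ m\<close> is zero, whatever the sign of
    \<open>c\<close>.\<close>
  have "(B *v u) $ m \<le> c * u $ m"
    using tp[of m] Bq[of m] by (simp add: Bu) (simp add: u_def algebra_simps)
  then have "u = 0"
    using offdiag_pos_null_entry[OF B u0 um] um by simp
  then have "t * (B *v p) $ i = (B *v q) $ i" and "t * p $ i = q $ i"
    using Bu[of i] by (auto simp: u_def)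
  moreover from this have "t * (c * p $ i) = c * q $ i"
    by (metis mult.left_commute)
  \<comment> \<open>The chain \<open>c * q $ i \<le> (B *v q) $ i = t * (B *v p) $ i \<le> t * (c *
    p $ i) = c * q $ i\<close> collapses.\<close>
  ultimately have "t * (B *v p) $ i = t * (c * p $ i)" "(B *v q) $ i = c * q $ i"
    using tp[of i] Bq[of i] by linarith+
  with t show ?thesis by simp
qed

section \<open>Strict improvement of the perturbed spectral abscissa\<close>

text \<open>The perturbation contributes equally to both sides and cancels, so row comparisons made
  for the original matrices carry over.\<close>

lemma perturbed_mult_less_iff:
  fixes A A' :: "real ^ 'd ^ 'd"
  shows "((A + \<epsilon> *\<^sub>R ones_matrix) *v x) $ i < ((A' + \<epsilon> *\<^sub>R ones_matrix) *v x) $ i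
    \<longleftrightarrow> row i A \<bullet> x < row i A' \<bullet> x"
  by (simp add: matrix_vector_mult_add_rdistrib matrix_vector_mul_component row_def)

lemma perturbed_offdiag_pos:
  assumes "metzler A" "0 < \<epsilon>" "j \<noteq> i"
  shows "0 < (A + \<epsilon> *\<^sub>R ones_matrix) $ i $ j"
  using assms by (auto simp: metzler_def ones_matrix_def intro: add_nonneg_pos)

text \<open>The sign \<open>s\<close> is 1 for maximization and \<open>-1\<close> for minimization.\<close>

definition improves :: "real \<Rightarrow> real ^ 'd ^ 'd \<Rightarrow> real ^ 'd \<Rightarrow> real ^ 'd ^ 'd \<Rightarrow> bool" where
  "improves s A v A' \<longleftrightarrow>
     (\<forall>i. row i A' = row i A \<or> s * (row i A \<bullet> v) < s * (row i A' \<bullet> v))"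

text \<open>For \<open>s = 1\<close>, the old eigenvector \<open>w\<close> is a subsolution for the
  new matrix with constant \<open>?l\<close>. Without an increase, \<open>w'\<close> would be a
  supersolution with the same constant, and the comparison would force equality in every row,
  including a changed one.\<close>

lemma improves_spectral_abscissa_less:
  fixes A A' :: "real ^ 'd ^ 'd"
  assumes s: "s = 1 \<or> s = -1" and A': "metzler A'" and A: "metzler A" and \<epsilon>: "0 < \<epsilon>"
    and w: "leading_eigenvector (A + \<epsilon> *\<^sub>R ones_matrix) w"
    and w': "leading_eigenvector (A' + \<epsilon> *\<^sub>R ones_matrix) w'"
    and imp: "improves s A w A'" and ne: "A' \<noteq> A"
  shows "s * spectral_abscissa (A + \<epsilon> *\<^sub>R ones_matrix)
       < s * spectral_abscissa (A' + \<epsilon> *\<^sub>R ones_matrix)" (is "s * ?l < s * ?m")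
proof (rule ccontr)
  assume le: "\<not> s * ?l < s * ?m"
  let ?B = "A' + \<epsilon> *\<^sub>R ones_matrix"
  have wp: "0 < w $ i" for i
    by (rule leading_eigenvector_pos[OF perturbed_offdiag_pos[OF A \<epsilon>] w])
  have wp': "0 < w' $ i" for i
    by (rule leading_eigenvector_pos[OF perturbed_offdiag_pos[OF A' \<epsilon>] w'])
  have Aw: "((A + \<epsilon> *\<^sub>R ones_matrix) *v w) $ i = ?l * w $ i" for i
    using w by (simp add: leading_eigenvector_def)
  have Bw': "(?B *v w') $ i = ?m * w' $ i" for i
    using w' by (simp add: leading_eigenvector_def)
  have l1: "row i A \<bullet> w < row i A' \<bullet> w \<longleftrightarrow> ?l * w $ i < (?B *v w) $ i" for i
    using perturbed_mult_less_iff[of A \<epsilon> w i A'] Aw[of i] by simp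
  have l2: "row i A' \<bullet> w < row i A \<bullet> w \<longleftrightarrow> (?B *v w) $ i < ?l * w $ i" for i
    using perturbed_mult_less_iff[of A' \<epsilon> w i A] Aw[of i] by simp
  obtain i where i: "row i A' \<noteq> row i A"
    using ne by (auto simp: vec_eq_iff row_def)
  from s show False
  proof
    assume s1: "s = 1"
    have "?l * w $ j \<le> (?B *v w) $ j" for j
      using imp l1[of j] l2[of j] unfolding improves_def s1
      by (metis mult_1 not_less order_less_irrefl order_less_imp_le)
    moreover have "(?B *v w') $ j \<le> ?l * w' $ j" for j
      using le wp'[of j] unfolding Bw' s1 by simp
    ultimately have "(?B *v w) $ i = ?l * w $ i"
      using offdiag_pos_sub_supersolution[OF perturbed_offdiag_pos[OF A' \<epsilon>] wp' wp, of ?l i]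
      by blast
    then show False using imp i l1[of i] by (auto simp: improves_def s1)
  next
    \<comment> \<open>The roles swap: \<open>w\<close> is now the supersolution and
      \<open>w'\<close> the subsolution.\<close>
    assume s1: "s = -1"
    have "(?B *v w) $ j \<le> ?l * w $ j" for j
      using imp l1[of j] l2[of j] unfolding improves_def s1
      by (metis mult_minus1 neg_less_iff_less not_less order_less_irrefl order_less_imp_le)
    moreover have "?l * w' $ j \<le> (?B *v w') $ j" for j
      using le wp'[of j] unfolding Bw' s1 by simp
    ultimately have "(?B *v w) $ i = ?l * w $ i"
      using offdiag_pos_sub_supersolution[OF perturbed_offdiag_pos[OF A' \<epsilon>] wp wp', of ?l i]
      by blast
    then show False using imp i l2[of i] by (auto simp: improves_def s1)
  qed
qed

text \<open>This is where the selection enters: \<open>v\<close> is the limit of the perturbed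
  eigenvectors \<open>w \<epsilon>\<close>, so by continuity strict inequalities at \<open>v\<close>
  persist at \<open>w \<epsilon>\<close> for small \<open>\<epsilon>\<close>.\<close>

lemma improves_eventually_spectral_abscissa:
  fixes A A' :: "real ^ 'd ^ 'd"
  assumes s: "s = 1 \<or> s = -1" and A: "metzler A" and A': "metzler A'"
    and sel: "selected_leading_eigenvector A v" and sel': "selected_leading_eigenvector A' v'"
    and imp: "improves s A v A'" and ne: "A' \<noteq> A"
  shows "\<forall>\<^sub>F \<epsilon> in at_right 0. s * spectral_abscissa (A + \<epsilon> *\<^sub>R ones_matrix)
       < s * spectral_abscissa (A' + \<epsilon> *\<^sub>R ones_matrix)"
proof -
  obtain w where w: "\<And>\<epsilon>. 0 < \<epsilon> \<Longrightarrow> leading_eigenvector (A + \<epsilon> *\<^sub>R ones_matrix) (w \<epsilon>)"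
    and lim: "(w \<longlongrightarrow> v) (at_right 0)"
    using sel unfolding selected_leading_eigenvector_def by blast
  \<comment> \<open>\<open>sel'\<close> serves to provide leading eigenvectors of the perturbed
    \<open>A'\<close>.\<close>
  obtain w' where w': "\<And>\<epsilon>. 0 < \<epsilon> \<Longrightarrow> leading_eigenvector (A' + \<epsilon> *\<^sub>R ones_matrix) (w' \<epsilon>)"
    using sel' unfolding selected_leading_eigenvector_def by blast
  have "\<forall>\<^sub>F \<epsilon> in at_right 0.
      row i A' = row i A \<or> s * (row i A \<bullet> w \<epsilon>) < s * (row i A' \<bullet> w \<epsilon>)" for i
  proof (cases "row i A' = row i A")
    case False
    with imp have less: "s * (row i A \<bullet> v) < s * (row i A' \<bullet> v)"
      by (auto simp: improves_def)
    have "((\<lambda>\<epsilon>. s * (row i A' \<bullet> w \<epsilon>) - s * (row i A \<bullet> w \<epsilon>)) \<longlongrightarrow>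
        s * (row i A' \<bullet> v) - s * (row i A \<bullet> v)) (at_right 0)"
      by (intro tendsto_intros lim)
    from order_tendstoD(1)[OF this, of 0] less show ?thesis
      by (auto elim: eventually_mono)
  qed simp
  then have "\<forall>\<^sub>F \<epsilon> in at_right 0. improves s A (w \<epsilon>) A'"
    unfolding improves_def by (rule eventually_all_finite)
  moreover have "\<forall>\<^sub>F \<epsilon> in at_right 0. (0::real) < \<epsilon>"
    by (rule eventually_at_right_less)
  ultimately show ?thesis
    by eventually_elim (use improves_spectral_abscissa_less s A A' w w' ne in blast)
qed

section \<open>Excluding cycles\<close>

lemma improving_sequence_no_cycle:
  fixes A :: "nat \<Rightarrow> real ^ 'd ^ 'd"
  assumes s: "s = 1 \<or> s = -1" and kl: "k < l"
    and met: "\<And>j. k \<le> j \<Longrightarrow> j < l \<Longrightarrow> metzler (A j)"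
    and sel: "\<And>j. k \<le> j \<Longrightarrow> j < l \<Longrightarrow> selected_leading_eigenvector (A j) (v j)"
    and imp: "\<And>j. k \<le> j \<Longrightarrow> j < l \<Longrightarrow> improves s (A j) (v j) (A (Suc j))"
    and ne: "A (Suc k) \<noteq> A k"
  shows "A l \<noteq> A k"
proof
  assume cyc: "A l = A k"
  let ?h = "\<lambda>\<epsilon> j. s * spectral_abscissa (A j + \<epsilon> *\<^sub>R ones_matrix)"
  have step: "\<forall>\<^sub>F \<epsilon> in at_right 0. A (Suc j) \<noteq> A j \<longrightarrow> ?h \<epsilon> j < ?h \<epsilon> (Suc j)"
    if j: "j \<in> {k..<l}" for j
  proof (cases "A (Suc j) = A j")
    case False
    \<comment> \<open>The last step leads to index \<open>l\<close>, outside the range of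
      \<open>met\<close> and \<open>sel\<close>; there the assumed return \<open>cyc\<close>
      transfers both facts from \<open>A k\<close>.\<close>
    have "metzler (A (Suc j)) \<and> (\<exists>u. selected_leading_eigenvector (A (Suc j)) u)"
    proof (cases "Suc j = l")
      case True
      then show ?thesis using cyc met[of k] sel[of k] kl by auto
    next
      case False
      then show ?thesis using j met[of "Suc j"] sel[of "Suc j"] by auto
    qed
    then show ?thesis
      using improves_eventually_spectral_abscissa[OF s met _ sel _ imp False] j
      by (auto elim: eventually_mono)
  qed simp
  have "\<forall>\<^sub>F \<epsilon> in at_right 0. \<forall>j\<in>{k..<l}. A (Suc j) \<noteq> A j \<longrightarrow> ?h \<epsilon> j < ?h \<epsilon> (Suc j)"
    using step by (intro eventually_ball_finite) auto
  then obtain \<epsilon> where \<epsilon>: "\<And>j. k \<le> j \<Longrightarrow> j < l \<Longrightarrow> A (Suc j) \<noteq> A j \<Longrightarrow> ?h \<epsilon> j < ?h \<epsilon> (Suc j)"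
    using eventually_happens'[OF trivial_limit_at_right_real] by fastforce
  \<comment> \<open>After the first step only weak monotonicity is claimed, since a step may leave
    the matrix unchanged; strictness comes from the step at \<open>k\<close>.\<close>
  have "?h \<epsilon> (Suc k) \<le> ?h \<epsilon> j" if "Suc k \<le> j" "j \<le> l" for j
    using that
  proof (induction j rule: dec_induct)
    case (step j)
    then show ?case
      using \<epsilon>[of j] by (cases "A (Suc j) = A j") auto
  qed simp
  then have "?h \<epsilon> (Suc k) \<le> ?h \<epsilon> l" using kl by simp
  moreover have "?h \<epsilon> k < ?h \<epsilon> (Suc k)" using \<epsilon> kl ne by simp
  ultimately show False by (simp add: cyc)
qed

text \<open>Abstracting from \<open>step\<close> lets maximization and minimization share the
  argument.\<close>

lemma selective_greedy_run_no_cycle: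
  assumes F: "product_family_rows F" and run: "selective_greedy_run step F N A v"
    and s: "s = 1 \<or> s = -1"
    and imp: "\<And>A v A'. step A v A' \<Longrightarrow> improves s A v A'"
    and mem: "\<And>A v A'. step A v A' \<Longrightarrow> A \<in> product_family F \<Longrightarrow> A' \<in> product_family F"
    and kl: "k < l" and l: "enat l \<le> N" and ne: "A (Suc k) \<noteq> A k"
  shows "A l \<noteq> A k"
proof -
  \<comment> \<open>For \<open>l = N\<close> the run constrains no eigenvector of
    \<open>A l\<close>, so the facts are collected for indices below \<open>l\<close> only.\<close>
  have lt: "enat j < N" if "j < l" for j
    using that l by (metis enat_ord_simps(2) order_less_le_trans)
  have st: "step (A j) (v j) (A (Suc j))" if "j < l" for j
    using run lt[OF that] by (auto simp: selective_greedy_run_def greedy_run_def)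
  have "A j \<in> product_family F" if "j < l" for j
    using that
  proof (induction j)
    case 0
    then show ?case using run by (auto simp: selective_greedy_run_def greedy_run_def)
  next
    case (Suc j)
    then show ?case using mem[OF st] by simp
  qed
  then have "metzler (A j)" if "j < l" for j
    using product_family_metzler[OF F] that by blast
  moreover have "selected_leading_eigenvector (A j) (v j)" if "j < l" for j
    using run lt[OF that] by (auto simp: selective_greedy_run_def)
  ultimately show ?thesis
    using improving_sequence_no_cycle[of s k l A v] s kl imp[OF st] ne by blast
qed

text \<open>The guard for replacing a row is itself the strict inequality demanded by
  \<open>improves\<close>; otherwise the row is kept.\<close>

lemma greedy_step_max_improves: "greedy_step_max F A v A' \<Longrightarrow> improves 1 A v A'"
  unfolding greedy_step_max_def improves_def by (metis mult_1)

lemma greedy_step_min_improves: "greedy_step_min F A v A' \<Longrightarrow> improves (-1) A v A'"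
  unfolding greedy_step_min_def improves_def by (metis mult_minus1 neg_less_iff_less)

lemma greedy_step_max_product_family:
  "greedy_step_max F A v A' \<Longrightarrow> A \<in> product_family F \<Longrightarrow> A' \<in> product_family F"
  unfolding greedy_step_max_def product_family_def mem_Collect_eq by metis

lemma greedy_step_min_product_family:
  "greedy_step_min F A v A' \<Longrightarrow> A \<in> product_family F \<Longrightarrow> A' \<in> product_family F"
  unfolding greedy_step_min_def product_family_def mem_Collect_eq by metis

theorem theorem6:
  fixes F :: "'d::finite \<Rightarrow> (real ^ 'd) set"
    and A :: "nat \<Rightarrow> real ^ 'd ^ 'd"
    and v :: "nat \<Rightarrow> real ^ 'd"
    and N :: enat
  assumes "product_family_rows F"
    and "selective_greedy_run (greedy_step_max F) F N A v \<or>
         selective_greedy_run (greedy_step_min F) F N A v"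
  shows "\<not> (\<exists>k l. k + 2 \<le> l \<and> enat l \<le> N \<and> A (Suc k) \<noteq> A k \<and> A l = A k)"
proof (intro notI, elim exE conjE)
  fix k l
  assume "k + 2 \<le> l" and l: "enat l \<le> N" and ne: "A (Suc k) \<noteq> A k" and cyc: "A l = A k"
  then have kl: "k < l" by simp
  from assms(2) show False
  proof
    assume run: "selective_greedy_run (greedy_step_max F) F N A v"
    have "A l \<noteq> A k"
      by (rule selective_greedy_run_no_cycle[OF assms(1) run _ greedy_step_max_improves
            greedy_step_max_product_family kl l ne]) simp_all
    with cyc show False by contradiction
  next
    assume run: "selective_greedy_run (greedy_step_min F) F N A v"
    have "A l \<noteq> A k"
      by (rule selective_greedy_run_no_cycle[OF assms(1) run _ greedy_step_min_improves
            greedy_step_min_product_family kl l ne]) simp_all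
    with cyc show False by contradiction
  qed
qed

end
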